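(* Let $A$ be a stable normed algebra. Then $A$ is faithful.
   Context: A normed algebra is an associative complex algebra with a norm satisfying $\|ab\|\le\|a\|\,\|b\|$ (not necessarily complete or unital). A normed algebra $A$ is left (resp. right) stable if for every $a\in A$ and every real $M>0$: whenever $\|ab\|\le M\|b\|$ (resp. $\|ba\|\le M\|b\|$) for all $b\in A$, then $\|a\|\le M$. $A$ is stable if it is both left and right stable. $A$ is left (resp. right) faithful if for all $x\in A$, $xA=0$ (resp. $Ax=0$) implies $x=0$; $A$ is faithful if it is both left and right faithful. *)

theory Defs
  imports "HOL-Analysis.Analysis"
begin

text \<open>
  Complex normed algebras, neither complete nor unital in general. The library only has the real
  version; it already supplies the associative ring, the norm and its submultiplicativity,
  so only a complex scalar multiplication extending the real one has to be added.
\<close>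

class complex_normed_algebra = real_normed_algebra +
  fixes scaleC :: "complex \<Rightarrow> 'a \<Rightarrow> 'a" (infixr \<open>*\<^sub>C\<close> 75)
  assumes scaleC_add_right: "c *\<^sub>C (x + y) = c *\<^sub>C x + c *\<^sub>C y"
    and scaleC_add_left: "(c + d) *\<^sub>C x = c *\<^sub>C x + d *\<^sub>C x"
    and scaleC_scaleC: "c *\<^sub>C (d *\<^sub>C x) = (c * d) *\<^sub>C x"
    and scaleC_of_real: "complex_of_real r *\<^sub>C x = r *\<^sub>R x"
    and norm_scaleC: "norm (c *\<^sub>C x) = cmod c * norm x"
    and mult_scaleC_left: "(c *\<^sub>C x) * y = c *\<^sub>C (x * y)"
    and mult_scaleC_right: "x * (c *\<^sub>C y) = c *\<^sub>C (x * y)"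

text \<open>The law \<open>1 *\<^sub>C x = x\<close> is the case \<open>r = 1\<close> of \<open>scaleC_of_real\<close>.\<close>

text \<open>
  The algebra is the whole type \<open>'a\<close>, so its properties are predicates on \<open>'a itself\<close>.
\<close>

definition left_stable :: "'a::complex_normed_algebra itself \<Rightarrow> bool" where
  "left_stable _ \<longleftrightarrow>
     (\<forall>(a::'a) (M::real). M > 0 \<longrightarrow> (\<forall>b::'a. norm (a * b) \<le> M * norm b) \<longrightarrow> norm a \<le> M)"

definition right_stable :: "'a::complex_normed_algebra itself \<Rightarrow> bool" where
  "right_stable _ \<longleftrightarrow>
     (\<forall>(a::'a) (M::real). M > 0 \<longrightarrow> (\<forall>b::'a. norm (b * a) \<le> M * norm b) \<longrightarrow> norm a \<le> M)"

definition stable_algebra :: "'a::complex_normed_algebra itself \<Rightarrow> bool" where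
  "stable_algebra A \<longleftrightarrow> left_stable A \<and> right_stable A"

definition left_faithful :: "'a::complex_normed_algebra itself \<Rightarrow> bool" where
  "left_faithful _ \<longleftrightarrow> (\<forall>x::'a. (\<forall>a::'a. x * a = 0) \<longrightarrow> x = 0)"

definition right_faithful :: "'a::complex_normed_algebra itself \<Rightarrow> bool" where
  "right_faithful _ \<longleftrightarrow> (\<forall>x::'a. (\<forall>a::'a. a * x = 0) \<longrightarrow> x = 0)"

definition faithful_algebra :: "'a::complex_normed_algebra itself \<Rightarrow> bool" where
  "faithful_algebra A \<longleftrightarrow> left_faithful A \<and> right_faithful A"

end

theory Submission
  imports Defs
begin

text \<open>If \<open>x\<close> annihilates the algebra from one side, all its products there have
  norm 0, so the premise of stability on that side holds for every \<open>M > 0\<close>. Stability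
  then bounds \<open>norm x\<close> by every positive \<open>M\<close>, which forces
  \<open>x = 0\<close>. \<open>left_stable_imp_left_faithful\<close> and
  \<open>right_stable_imp_right_faithful\<close> carry this out, each from its own half of
  stability.\<close>

lemma left_stable_imp_left_faithful:
  assumes "left_stable TYPE('a::complex_normed_algebra)"
  shows "left_faithful TYPE('a)"
  unfolding left_faithful_def
proof (intro allI impI)
  fix x :: 'a
  assume "\<forall>a. x * a = 0"
  then have "norm (x * a) \<le> M * norm a" if "M > 0" for M and a :: 'a
    using that by simp
  then have "norm x \<le> M" if "M > 0" for M
    using assms that unfolding left_stable_def by blast
  \<comment> \<open>Stability cannot be applied at \<open>M = 0\<close>, so 0 is reached as a limit:
    the bound is used at \<open>M = 0 + e\<close> for arbitrary \<open>e > 0\<close>.\<close>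
  then have "norm x \<le> 0"
    by (rule field_le_epsilon) simp
  then show "x = 0"
    by simp
qed

text \<open>The same argument with the factors swapped; as the product need not commute, it rests on
  right stability.\<close>

lemma right_stable_imp_right_faithful:
  assumes "right_stable TYPE('a::complex_normed_algebra)"
  shows "right_faithful TYPE('a)"
  unfolding right_faithful_def
proof (intro allI impI)
  fix x :: 'a
  assume "\<forall>a. a * x = 0"
  then have "norm (a * x) \<le> M * norm a" if "M > 0" for M and a :: 'a
    using that by simp
  then have "norm x \<le> M" if "M > 0" for M
    using assms that unfolding right_stable_def by blast
  then have "norm x \<le> 0"
    by (rule field_le_epsilon) simp
  then show "x = 0"
    by simp
qed

theorem proposition2p2:
  assumes "stable_algebra TYPE('a::complex_normed_algebra)"
  shows "faithful_algebra TYPE('a)"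
  using assms left_stable_imp_left_faithful right_stable_imp_right_faithful
  unfolding stable_algebra_def faithful_algebra_def by blast

end
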